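(* If $0<\theta\le1$, then for each $k\ge1$ and each $w\in\mathcal{C}_{2k}$, $p_\theta(w)=1$.
   Context: For $\theta\in(0,\infty)$ and $n$ large enough that $\lfloor n/\theta\rfloor\ge1$, let $L_\theta(i,j)=(i+j)\bmod\lfloor n/\theta\rfloor$ for $1\le i,j\le n$. A word of length $2k$ is a sequence of $2k$ letters whose first occurrences are in alphabetical order; $w[i]$ is its $i$-th letter; it is pair-matched if every letter appears exactly twice. A pair-matched word is Catalan if sequentially deleting all double letters (two adjacent equal letters) reduces the word to the empty word (e.g. $aabb$, $abbcca$); $\mathcal{C}_{2k}$ is the set of Catalan words of length $2k$. A circuit of length $2k$ is a function $\pi:\{0,\dots,2k\}\to\{1,\dots,n\}$ with $\pi(0)=\pi(2k)$. For a pair-matched word $w$ of length $2k$, $\Pi_\theta^*(w)$ is the set of such circuits for which $w[i]=w[j]$ implies $L_\theta(\pi(i-1),\pi(i))=L_\theta(\pi(j-1),\pi(j))$, and $p_\theta(w)=\lim_{n\to\infty}n^{-(k+1)}\#\Pi_\theta^*(w)$ (this limit exists). *)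

theory Defs
  imports Complex_Main "HOL-Library.FuncSet"
begin

(* The letters a, b, c, ... are encoded as 0, 1, 2, ...: a letter occurring for the first
   time is the next unused letter of the alphabet. *)
definition is_word :: "nat list \<Rightarrow> bool" where
  "is_word w \<longleftrightarrow>
     (\<forall>i < length w. w ! i \<in> set (take i w) \<or> w ! i = card (set (take i w)))"

definition pair_matched :: "nat list \<Rightarrow> bool" where
  "pair_matched w \<longleftrightarrow> (\<forall>a \<in> set w. count_list w a = 2)"

(* Deletion acts on arbitrary letter sequences, since an intermediate sequence such as
   "bb" (obtained from "aabb") need not be a word. *)
inductive delete_double :: "nat list \<Rightarrow> nat list \<Rightarrow> bool" where
  "delete_double (u @ [a, a] @ v) (u @ v)"

(* The argument m is the length of the words, so the set C_{2k} is catalan_words (2 * k). *)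
definition catalan_words :: "nat \<Rightarrow> nat list set" where
  "catalan_words m =
     {w. is_word w \<and> length w = m \<and> pair_matched w \<and> delete_double\<^sup>*\<^sup>* w []}"

definition L :: "real \<Rightarrow> nat \<Rightarrow> nat \<Rightarrow> nat \<Rightarrow> nat" where
  "L \<theta> n i j = (i + j) mod nat \<lfloor>real n / \<theta>\<rfloor>"

(* Extensional functions, so that a circuit is determined by its values on {0..m}. *)
definition circuits :: "nat \<Rightarrow> nat \<Rightarrow> (nat \<Rightarrow> nat) set" where
  "circuits n m = {\<pi> \<in> {0..m} \<rightarrow>\<^sub>E {1..n}. \<pi> 0 = \<pi> m}"

(* The i-th letter (counting from 1) of w is w ! (i - 1). *)
definition Pi_star :: "real \<Rightarrow> nat list \<Rightarrow> nat \<Rightarrow> (nat \<Rightarrow> nat) set" where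
  "Pi_star \<theta> w n =
     {\<pi> \<in> circuits n (length w).
        \<forall>i \<in> {1..length w}. \<forall>j \<in> {1..length w}.
          w ! (i - 1) = w ! (j - 1) \<longrightarrow>
          L \<theta> n (\<pi> (i - 1)) (\<pi> i) = L \<theta> n (\<pi> (j - 1)) (\<pi> j)}"

(* For a word of length 2k the exponent below is k + 1. *)
definition circuit_ratio :: "real \<Rightarrow> nat list \<Rightarrow> nat \<Rightarrow> real" where
  "circuit_ratio \<theta> w n = real (card (Pi_star \<theta> w n)) / real n ^ (length w div 2 + 1)"

definition p :: "real \<Rightarrow> nat list \<Rightarrow> real" where
  "p \<theta> w = lim (circuit_ratio \<theta> w)"

end

theory Submission
  imports Defs
begin

text \<open>
  Since $\theta \le 1$, the modulus $M = \lfloor n/\theta \rfloor$ is at least $n$, so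
  congruent elements of $\{1,\dots,n\}$ are equal. A double letter at steps $l+1$ and $l+2$
  therefore means just $\pi(l) = \pi(l+2)$ and leaves $\pi(l+1)$ free. As the letter occurs
  nowhere else, deleting it divides the number of circuits by exactly $n$; a Catalan word of
  length $2k$ thus has exactly $n^{k+1}$ circuits for every $n \ge 1$.
\<close>

lemma modulus_ge:
  fixes \<theta> :: real
  assumes "0 < \<theta>" "\<theta> \<le> 1"
  shows "n \<le> nat \<lfloor>real n / \<theta>\<rfloor>"
proof -
  have "real n \<le> real n / \<theta>"
    using assms by (simp add: pos_le_divide_eq mult_left_le)
  then show ?thesis
    by (simp add: le_nat_floor)
qed

text \<open>The set \<open>{1..M}\<close> is a complete residue system modulo \<open>M\<close>. The
  sums are written as for two consecutive steps of a circuit, with \<open>y\<close> the common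
  vertex.\<close>

lemma add_mod_left_cancel:
  fixes x y z M :: nat
  assumes "(x + y) mod M = (y + z) mod M" "x \<in> {1..M}" "z \<in> {1..M}"
  shows "x = z"
proof -
  have *: "a = b"
    if "b \<le> a" and eq: "(y + a) mod M = (y + b) mod M" and "a \<in> {1..M}" "b \<in> {1..M}"
    for a b
  proof -
    obtain s where "y + a = y + b + M * s"
      using mod_eq_nat1E[OF eq] \<open>b \<le> a\<close> by auto
    then have "a = b + M * s" by simp
    then show ?thesis
      \<comment> \<open>A positive \<open>s\<close> would force \<open>a > M\<close>, because
        \<open>b\<close> is at least 1.\<close>
      using that by (cases s) auto
  qed
  show ?thesis
  proof (cases "z \<le> x")
    case True
    then show ?thesis using *[of z x] assms by (simp add: add.commute)
  next
    case False
    then show ?thesis using *[of x z] assms by (simp add: add.commute)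
  qed
qed

lemma Pi_star_iff:
  \<comment> \<open>Passing to indices from 0 matches list indexing: letter \<open>i\<close> then
    labels the step from \<open>\<pi> i\<close> to \<open>\<pi> (Suc i)\<close>.\<close>
  "\<pi> \<in> Pi_star \<theta> w n \<longleftrightarrow>
     \<pi> \<in> circuits n (length w) \<and>
     (\<forall>i < length w. \<forall>j < length w. w ! i = w ! j \<longrightarrow>
        L \<theta> n (\<pi> i) (\<pi> (Suc i)) = L \<theta> n (\<pi> j) (\<pi> (Suc j)))"
proof -
  have *: "(\<forall>i \<in> {1..m}. Q i) \<longleftrightarrow> (\<forall>i < m. Q (Suc i))" for m and Q :: "nat \<Rightarrow> bool"
    by (metis One_nat_def Suc_le_eq Suc_pred atLeastAtMost_iff le_add1 plus_1_eq_Suc)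
  show ?thesis
    unfolding Pi_star_def * by simp
qed

text \<open>The walk goes from \<open>\<sigma> l\<close> to \<open>y\<close> and straight back: at
  \<open>l + 2\<close> the last branch returns \<open>\<sigma> l\<close> again.\<close>

definition insert_detour :: "nat \<Rightarrow> (nat \<Rightarrow> nat) \<Rightarrow> nat \<Rightarrow> nat \<Rightarrow> nat" where
  "insert_detour l \<sigma> y i = (if i \<le> l then \<sigma> i else if i = Suc l then y else \<sigma> (i - 2))"

definition remove_detour :: "nat \<Rightarrow> (nat \<Rightarrow> nat) \<Rightarrow> nat \<Rightarrow> nat" where
  "remove_detour l \<pi> i = (if i \<le> l then \<pi> i else \<pi> (i + 2))"

text \<open>By \<open>l \<le> m\<close>, position \<open>m + 2\<close> inherits
  \<open>\<sigma> m\<close>, even when \<open>l = m\<close>, and arguments beyond it are sent beyond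
  \<open>m\<close>, so extensionality survives.\<close>

lemma insert_detour_in_circuits:
  assumes "l \<le> m" "\<sigma> \<in> circuits n m" "y \<in> {1..n}"
  shows "insert_detour l \<sigma> y \<in> circuits n (m + 2)"
  using assms unfolding circuits_def insert_detour_def
  by (auto simp: PiE_iff extensional_def)

lemma remove_detour_in_circuits:
  assumes "l \<le> m" "\<pi> \<in> circuits n (m + 2)" "\<pi> l = \<pi> (l + 2)"
  shows "remove_detour l \<pi> \<in> circuits n m"
  using assms unfolding circuits_def remove_detour_def
  by (auto simp: PiE_iff extensional_def)

lemma remove_insert_detour: "remove_detour l (insert_detour l \<sigma> y) = \<sigma>"
  by (auto simp: fun_eq_iff remove_detour_def insert_detour_def)

lemma insert_remove_detour:
  assumes "\<pi> l = \<pi> (l + 2)"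
  shows "insert_detour l (remove_detour l \<pi>) (\<pi> (Suc l)) = \<pi>"
proof
  fix i
  consider "i \<le> l" | "i = Suc l" | "i = l + 2" | "l + 2 < i" by linarith
  then show "insert_detour l (remove_detour l \<pi>) (\<pi> (Suc l)) i = \<pi> i"
    using assms by cases (auto simp: remove_detour_def insert_detour_def simp flip: add_2_eq_Suc')
qed

text \<open>The steps to and from \<open>y\<close> have the same value because \<open>L\<close> is
  symmetric. All other steps are translated steps of \<sigma>, and freshness of \<open>a\<close>
  rules out constraints between the two kinds.\<close>

lemma insert_detour_in_Pi_star:
  assumes a: "a \<notin> set u" "a \<notin> set v"
    and \<sigma>: "\<sigma> \<in> Pi_star \<theta> (u @ v) n" and y: "y \<in> {1..n}"
  shows "insert_detour (length u) \<sigma> y \<in> Pi_star \<theta> (u @ [a, a] @ v) n"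
proof -
  let ?l = "length u" and ?w = "u @ [a, a] @ v"
  let ?\<pi> = "insert_detour ?l \<sigma> y"
  \<comment> \<open>The position in \<open>u @ v\<close> of a letter of \<open>?w\<close>,
    meaningful only away from the two inserted positions.\<close>
  define orig where "orig i = (if i < ?l then i else i - 2)" for i
  have old: "orig i < length (u @ v)" "?w ! i = (u @ v) ! orig i"
      "L \<theta> n (?\<pi> i) (?\<pi> (Suc i)) = L \<theta> n (\<sigma> (orig i)) (\<sigma> (Suc (orig i)))"
      "?w ! i \<noteq> a"
    if i: "i < length ?w" "i \<noteq> ?l" "i \<noteq> Suc ?l" for i
  proof -
    consider "i < ?l" | "?l + 2 \<le> i" using i by linarith
    then have "orig i < length (u @ v) \<and> ?w ! i = (u @ v) ! orig i
        \<and> L \<theta> n (?\<pi> i) (?\<pi> (Suc i)) = L \<theta> n (\<sigma> (orig i)) (\<sigma> (Suc (orig i)))"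
    proof cases
      case 1
      then show ?thesis by (simp add: orig_def insert_detour_def nth_append)
    next
      case 2
      then obtain j where "i = ?l + 2 + j" using le_Suc_ex by blast
      then show ?thesis
        using that(1) by (simp add: orig_def insert_detour_def nth_append)
    qed
    moreover have "(u @ v) ! orig i \<in> set (u @ v)"
      using calculation nth_mem by blast
    ultimately show "orig i < length (u @ v)" "?w ! i = (u @ v) ! orig i"
      "L \<theta> n (?\<pi> i) (?\<pi> (Suc i)) = L \<theta> n (\<sigma> (orig i)) (\<sigma> (Suc (orig i)))"
      "?w ! i \<noteq> a"
      using a by auto
  qed
  have new: "?w ! i = a" "L \<theta> n (?\<pi> i) (?\<pi> (Suc i)) = L \<theta> n (\<sigma> ?l) y"
    if "i = ?l \<or> i = Suc ?l" for i
    using that by (auto simp: insert_detour_def nth_append L_def add.commute)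
  have "?\<pi> \<in> circuits n (length ?w)"
    using insert_detour_in_circuits[of ?l "length (u @ v)" \<sigma> n y] \<sigma> y
    by (simp add: Pi_star_iff)
  moreover have "L \<theta> n (?\<pi> i) (?\<pi> (Suc i)) = L \<theta> n (?\<pi> j) (?\<pi> (Suc j))"
    if "i < length ?w" "j < length ?w" "?w ! i = ?w ! j" for i j
  proof (cases "i = ?l \<or> i = Suc ?l")
    case True
    then have "j = ?l \<or> j = Suc ?l"
      using new(1)[of i] old(4)[of j] that by metis
    then show ?thesis using new(2) True by metis
  next
    case False
    then have "\<not> (j = ?l \<or> j = Suc ?l)"
      using new(1)[of j] old(4)[of i] that by metis
    then show ?thesis
      using False old(1-3)[of i] old(1-3)[of j] that \<sigma> unfolding Pi_star_iff by metis
  qed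
  ultimately show ?thesis
    unfolding Pi_star_iff by blast
qed

lemma remove_detour_in_Pi_star:
  assumes \<pi>: "\<pi> \<in> Pi_star \<theta> (u @ [a, a] @ v) n"
    and closed: "\<pi> (length u) = \<pi> (length u + 2)"
  shows "remove_detour (length u) \<pi> \<in> Pi_star \<theta> (u @ v) n"
proof -
  let ?l = "length u" and ?w = "u @ [a, a] @ v"
  let ?\<sigma> = "remove_detour ?l \<pi>"
  define shift where "shift i = (if i < ?l then i else i + 2)" for i
  have shift: "shift i < length ?w" "?w ! shift i = (u @ v) ! i"
      "L \<theta> n (?\<sigma> i) (?\<sigma> (Suc i)) = L \<theta> n (\<pi> (shift i)) (\<pi> (Suc (shift i)))"
    if "i < length (u @ v)" for i
  proof -
    show "shift i < length ?w"
      using that by (simp add: shift_def)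
    show "?w ! shift i = (u @ v) ! i"
      by (auto simp: shift_def nth_append Suc_diff_le)
    show "L \<theta> n (?\<sigma> i) (?\<sigma> (Suc i)) = L \<theta> n (\<pi> (shift i)) (\<pi> (Suc (shift i)))"
      \<comment> \<open>The assumption \<open>closed\<close> matters at \<open>i = ?l\<close>: there
        \<open>?\<sigma>\<close> starts its step at \<open>\<pi> ?l\<close>, whereas the shifted
        step starts at \<open>\<pi> (?l + 2)\<close>.\<close>
      using closed by (cases i ?l rule: linorder_cases) (auto simp: shift_def remove_detour_def)
  qed
  have "?\<sigma> \<in> circuits n (length (u @ v))"
    using remove_detour_in_circuits[of ?l "length (u @ v)" \<pi> n] \<pi> closed
    by (simp add: Pi_star_iff)
  then show ?thesis
    using \<pi> shift unfolding Pi_star_iff by metis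
qed

text \<open>This is where the size of the modulus enters the count: a smaller positive modulus would
  only make the two vertices congruent.\<close>

lemma Pi_star_double_letter:
  assumes M: "n \<le> nat \<lfloor>real n / \<theta>\<rfloor>"
    and \<pi>: "\<pi> \<in> Pi_star \<theta> (u @ [a, a] @ v) n"
  shows "\<pi> (length u) = \<pi> (length u + 2)"
proof -
  let ?l = "length u" and ?w = "u @ [a, a] @ v"
  have range: "\<pi> i \<in> {1..n}" if "i \<le> length ?w" for i
    using \<pi> that unfolding Pi_star_iff circuits_def by (auto simp: PiE_iff)
  have "?w ! ?l = ?w ! Suc ?l" "?l < length ?w" "Suc ?l < length ?w"
    by (auto simp: nth_append)
  then have "L \<theta> n (\<pi> ?l) (\<pi> (Suc ?l)) = L \<theta> n (\<pi> (Suc ?l)) (\<pi> (Suc (Suc ?l)))"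
    using \<pi> unfolding Pi_star_iff by blast
  moreover have "\<pi> ?l \<in> {1..nat \<lfloor>real n / \<theta>\<rfloor>}" "\<pi> (Suc (Suc ?l)) \<in> {1..nat \<lfloor>real n / \<theta>\<rfloor>}"
    using range[of ?l] range[of "Suc (Suc ?l)"] M by auto
  ultimately show ?thesis
    using add_mod_left_cancel unfolding L_def by (metis add_2_eq_Suc')
qed

lemma card_Pi_star_delete_double:
  assumes M: "n \<le> nat \<lfloor>real n / \<theta>\<rfloor>" and a: "a \<notin> set u" "a \<notin> set v"
  shows "card (Pi_star \<theta> (u @ [a, a] @ v) n) = n * card (Pi_star \<theta> (u @ v) n)"
proof -
  let ?l = "length u" and ?w = "u @ [a, a] @ v"
  have "bij_betw (\<lambda>(\<sigma>, y). insert_detour ?l \<sigma> y)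
          (Pi_star \<theta> (u @ v) n \<times> {1..n}) (Pi_star \<theta> ?w n)"
  \<comment> \<open>The inverse reads the free vertex off at position \<open>?l + 1\<close>, where
    the detour turns back.\<close>
  proof (rule bij_betw_byWitness[where f' = "\<lambda>\<pi>. (remove_detour ?l \<pi>, \<pi> (Suc ?l))"])
    show "\<forall>x \<in> Pi_star \<theta> (u @ v) n \<times> {1..n}.
        (\<lambda>\<pi>. (remove_detour ?l \<pi>, \<pi> (Suc ?l))) ((\<lambda>(\<sigma>, y). insert_detour ?l \<sigma> y) x) = x"
      by (auto simp: remove_insert_detour) (simp add: insert_detour_def)
    show "\<forall>\<pi> \<in> Pi_star \<theta> ?w n.
        (\<lambda>(\<sigma>, y). insert_detour ?l \<sigma> y) (remove_detour ?l \<pi>, \<pi> (Suc ?l)) = \<pi>"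
      using insert_remove_detour Pi_star_double_letter[OF M] by auto
    show "(\<lambda>(\<sigma>, y). insert_detour ?l \<sigma> y) ` (Pi_star \<theta> (u @ v) n \<times> {1..n}) \<subseteq> Pi_star \<theta> ?w n"
      using insert_detour_in_Pi_star[OF a] by auto
    have "\<pi> (Suc ?l) \<in> {1..n}" if "\<pi> \<in> Pi_star \<theta> ?w n" for \<pi>
      using that unfolding Pi_star_iff circuits_def by (auto simp: PiE_iff)
    then show "(\<lambda>\<pi>. (remove_detour ?l \<pi>, \<pi> (Suc ?l))) ` Pi_star \<theta> ?w n
        \<subseteq> Pi_star \<theta> (u @ v) n \<times> {1..n}"
      using remove_detour_in_Pi_star Pi_star_double_letter[OF M] by blast
  qed
  from bij_betw_same_card[OF this] show ?thesis
    by (simp add: card_cartesian_product mult.commute)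
qed

text \<open>The two displayed copies exhaust the count of \<open>a\<close>, and they contribute
  nothing to the count of any other letter.\<close>

lemma pair_matched_delete_double:
  assumes "pair_matched (u @ [a, a] @ v)"
  shows "a \<notin> set u" "a \<notin> set v" "pair_matched (u @ v)"
proof -
  have count: "count_list u b + count_list [a, a] b + count_list v b = 2"
    if "b \<in> set (u @ [a, a] @ v)" for b
    using bspec[OF assms[unfolded pair_matched_def] that] by (cases "a = b") simp_all
  show au: "a \<notin> set u" and av: "a \<notin> set v"
    using count[of a] by (auto simp: count_list_0_iff)
  show "pair_matched (u @ v)"
    unfolding pair_matched_def
  proof
    fix b assume b: "b \<in> set (u @ v)"
    then have "a \<noteq> b" using au av by auto
    then show "count_list (u @ v) b = 2" using count[of b] b by auto
  qed
qed

text \<open>A circuit of length 0 is the choice of a single vertex; this accounts for the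
  \<open>+ 1\<close> in the exponent.\<close>

lemma card_circuits_0: "card (circuits n 0) = n"
  by (simp add: circuits_def card_PiE)

text \<open>The induction carries \<open>pair_matched\<close>, which survives a deletion, whereas
  \<open>is_word\<close> may be lost, as when \<open>aabb\<close> becomes \<open>bb\<close>.\<close>

lemma card_Pi_star_catalan:
  assumes "delete_double\<^sup>*\<^sup>* w []" "pair_matched w" "n \<le> nat \<lfloor>real n / \<theta>\<rfloor>"
  shows "card (Pi_star \<theta> w n) = n ^ (length w div 2 + 1)"
  using assms(1,2)
proof (induction rule: converse_rtranclp_induct)
  case base
  have "Pi_star \<theta> [] n = circuits n 0" by (auto simp: Pi_star_def)
  then show ?case by (simp add: card_circuits_0)
next
  case (step w w')
  from step.hyps(1) obtain u a v where w: "w = u @ [a, a] @ v" "w' = u @ v"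
    by (auto elim: delete_double.cases)
  note del = pair_matched_delete_double[OF step.prems[unfolded w]]
  have "card (Pi_star \<theta> w n) = n * n ^ (length w' div 2 + 1)"
    using card_Pi_star_delete_double[OF assms(3) del(1,2)] step.IH del(3) w by simp
  \<comment> \<open>Since \<open>w\<close> is two letters longer than \<open>w'\<close>, the new
    factor \<open>n\<close> is the increase of the half-length by one.\<close>
  then show ?case by (simp add: w)
qed

theorem corollary4p1:
  fixes \<theta> :: real and k :: nat and w :: "nat list"
  assumes "0 < \<theta>" and "\<theta> \<le> 1"
    and "k \<ge> 1"
    and "w \<in> catalan_words (2 * k)"
  shows "convergent (circuit_ratio \<theta> w) \<and> p \<theta> w = 1"
proof -
  \<comment> \<open>At \<open>n = 0\<close> the ratio is \<open>0 / 0\<close>, which is 0 in HOL, so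
    the sequence is constant only from 1 on.\<close>
  have "circuit_ratio \<theta> w n = 1" if "n \<ge> 1" for n
    using card_Pi_star_catalan[OF _ _ modulus_ge[OF assms(1,2)], of w n] assms(4) that
    by (simp add: circuit_ratio_def catalan_words_def)
  then have "circuit_ratio \<theta> w \<longlonglongrightarrow> 1"
    by (intro tendsto_eventually eventually_sequentiallyI[of 1])
  then show ?thesis
    unfolding p_def by (auto simp: convergent_def dest: limI)
qed

end
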